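(* Let $H$ be a fixed connected simple graph with at least two vertices and $\{G_n\}$ a sequence of finite simple graphs, each containing at least one copy of $H$. Suppose there is $\varepsilon>0$ such that for every $N$ there exists $n>N$ for which $G_n$ has an $\varepsilon$-strongly influential pair of distinct vertices $\mathbf w=(v,w)$, i.e. a pair with $D_{\mathbf w}(H,G_n)\ge\varepsilon N(H,G_n)$. Then $Z(H,G_n)$ does not converge in law to $\mathcal N(0,1)$ as $n\to\infty$.
   Context: A copy of $H$ in $G$ is a (not necessarily induced) subgraph of $G$ isomorphic to $H$. $N(H,G_n)$ is the number of copies of $H$ in $G_n$, and for a pair $\mathbf w=(v,w)$ of distinct vertices, $D_{\mathbf w}(H,G_n)$ is the number of copies of $H$ in $G_n$ whose vertex set contains both $v$ and $w$. Color each vertex of $G_n$ independently and uniformly with one of two colors; $T(H,G_n)$ is the number of copies of $H$ in $G_n$ all of whose vertices have the same color, and $Z(H,G_n)=(T(H,G_n)-\mathbb E[T(H,G_n)])/\sqrt{\mathrm{Var}(T(H,G_n))}$. *)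

theory Defs
  imports "HOL-Probability.Probability" "Graph_Theory.Graph_Theory"
begin

text \<open>
  Finite simple graphs are rendered by the locale \<^locale>\<open>pair_graph\<close>: a finite vertex set with a
  finite, symmetric, loop-free set of arcs, the edge between \<open>u\<close> and \<open>v\<close> being the two arcs
  \<open>(u, v)\<close> and \<open>(v, u)\<close>.
\<close>

definition copies :: "'h pair_pre_digraph \<Rightarrow> 'v pair_pre_digraph \<Rightarrow> 'v pair_pre_digraph set" where
  "copies H G =
     {K. pair_graph K \<and> subgraph (with_proj K) (with_proj G) \<and>
         digraph_iso (with_proj K) (with_proj H)}"

definition num_copies :: "'h pair_pre_digraph \<Rightarrow> 'v pair_pre_digraph \<Rightarrow> nat" where
  "num_copies H G = card (copies H G)"

definition num_copies_through ::
    "'v \<times> 'v \<Rightarrow> 'h pair_pre_digraph \<Rightarrow> 'v pair_pre_digraph \<Rightarrow> nat" where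
  "num_copies_through w H G = card {K \<in> copies H G. fst w \<in> pverts K \<and> snd w \<in> pverts K}"

definition strongly_influential ::
    "real \<Rightarrow> 'h pair_pre_digraph \<Rightarrow> 'v pair_pre_digraph \<Rightarrow> 'v \<times> 'v \<Rightarrow> bool" where
  "strongly_influential \<epsilon> H G w \<longleftrightarrow>
     fst w \<in> pverts G \<and> snd w \<in> pverts G \<and> fst w \<noteq> snd w \<and>
     real (num_copies_through w H G) \<ge> \<epsilon> * real (num_copies H G)"

text \<open>
  The two colours are the booleans. The value \<^const>\<open>False\<close> that \<^const>\<open>Pi_pmf\<close> assigns outside the
  vertex set is a dummy.
\<close>

definition random_colouring :: "'v pair_pre_digraph \<Rightarrow> ('v \<Rightarrow> bool) pmf" where
  "random_colouring G = Pi_pmf (pverts G) False (\<lambda>_. pmf_of_set UNIV)"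

definition mono_copies ::
    "'h pair_pre_digraph \<Rightarrow> 'v pair_pre_digraph \<Rightarrow> ('v \<Rightarrow> bool) \<Rightarrow> real" where
  "mono_copies H G x = real (card {K \<in> copies H G. \<exists>c. \<forall>v\<in>pverts K. x v = c})"

definition standardized_mono_copies ::
    "'h pair_pre_digraph \<Rightarrow> 'v pair_pre_digraph \<Rightarrow> ('v \<Rightarrow> bool) \<Rightarrow> real" where
  "standardized_mono_copies H G x =
     (mono_copies H G x - measure_pmf.expectation (random_colouring G) (mono_copies H G)) /
     sqrt (measure_pmf.variance (random_colouring G) (mono_copies H G))"

end

theory Submission
  imports Defs
begin

text \<open>
  The sign \<open>Y\<close>, equal to \<open>1\<close> if \<open>v\<close> and \<open>w\<close> get the same colour and to \<open>-1\<close> otherwise, is a centred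
  variable of variance \<open>1\<close>. Flipping the colour of one of the two vertices shows that \<open>Y\<close> is
  uncorrelated with the event that a given copy is monochromatic, unless this copy contains both \<open>v\<close>
  and \<open>w\<close>. Hence the covariance of \<open>T\<close> and \<open>Y\<close> is at least \<open>D/2\<^sup>r\<close>, where \<open>r\<close> is the number of
  vertices of \<open>H\<close>, and by Cauchy--Schwarz the standard deviation of \<open>T\<close> is at least
  \<open>D/2\<^sup>r \<ge> \<epsilon>N/2\<^sup>r\<close> for a strongly influential pair. As \<open>0 \<le> T \<le> N\<close>, this bounds \<open>Z\<close> from below by
  \<open>-2\<^sup>r/\<epsilon>\<close> infinitely often, which a limit with full support on the real line rules out.
\<close>

text \<open>Weak convergence yields convergence of the distribution functions only at continuity
  points of the limit. A measure with a density has no atoms, so every point qualifies here.\<close>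

lemma isCont_cdf_std_normal: "isCont (cdf std_normal_distribution) x"
proof -
  interpret real_distribution std_normal_distribution
    by (rule real_dist_normal_dist)
  have "AE y in lborel. y \<in> {x} \<longrightarrow> ennreal (std_normal_density y) = 0"
    using AE_lborel_singleton[of x] by eventually_elim simp
  then have "{x} \<in> null_sets std_normal_distribution"
    by (subst null_sets_density_iff) auto
  then show ?thesis
    by (simp add: isCont_cdf measure_eq_0_null_sets)
qed

text \<open>The density is positive everywhere, so a half-line of measure zero would be
  Lebesgue-null, although it contains an interval of length 1.\<close>

lemma cdf_std_normal_pos: "cdf std_normal_distribution x > 0"
proof (rule ccontr)
  interpret real_distribution std_normal_distribution
    by (rule real_dist_normal_dist)
  assume "\<not> ?thesis"
  then have "measure std_normal_distribution {..x} = 0"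
    by (simp add: cdf_def not_less measure_le_0_iff)
  then have "{..x} \<in> null_sets std_normal_distribution"
    by (auto simp: null_sets_def emeasure_eq_measure)
  then have "AE y in lborel. y \<in> {..x} \<longrightarrow> ennreal (std_normal_density y) = 0"
    by (subst (asm) null_sets_density_iff) auto
  moreover have "std_normal_density y > 0" for y
    by (rule normal_density_pos) simp
  ultimately have "AE y in lborel. y \<notin> {..x}"
    by (auto simp: ennreal_eq_0_iff not_le[symmetric])
  then have "emeasure lborel {y \<in> space lborel. y \<in> {x - 1..x}} = 0"
    by (intro emeasure_eq_0_AE) (auto elim: eventually_mono)
  then have "emeasure lborel {x - 1..x} = 0"
    by (simp only: space_lborel space_borel UNIV_I simp_thms Collect_mem_eq)
  then show False
    by simp
qed

lemma not_weak_conv_std_normal_if_bounded_below: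
  assumes "\<And>m. \<exists>n>m. \<forall>x\<in>set_pmf (p n). c \<le> f n x"
  shows "\<not> weak_conv_m (\<lambda>n. distr (measure_pmf (p n)) borel (f n)) std_normal_distribution"
proof
  assume "weak_conv_m (\<lambda>n. distr (measure_pmf (p n)) borel (f n)) std_normal_distribution"
  \<comment> \<open>The point \<open>c - 1\<close> lies strictly below \<open>c\<close>, so possible
    mass of \<open>f n\<close> at \<open>c\<close> itself does not count. The distribution function
    vanishes there for infinitely many \<open>n\<close>, but its limit is positive.\<close>
  then have "(\<lambda>n. cdf (distr (measure_pmf (p n)) borel (f n)) (c - 1))
      \<longlonglongrightarrow> cdf std_normal_distribution (c - 1)"
    by (auto simp: weak_conv_m_def weak_conv_def isCont_cdf_std_normal)
  then have "eventually (\<lambda>n. cdf (distr (measure_pmf (p n)) borel (f n)) (c - 1) > 0) sequentially"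
    using cdf_std_normal_pos by (rule order_tendstoD)
  then obtain m where m: "\<And>n. n \<ge> m \<Longrightarrow> cdf (distr (measure_pmf (p n)) borel (f n)) (c - 1) > 0"
    by (auto simp: eventually_sequentially)
  obtain n where n: "n > m" "\<forall>x\<in>set_pmf (p n). c \<le> f n x"
    using assms by blast
  have "measure_pmf.prob (p n) (f n -` {..c - 1}) = 0"
    using n by (fastforce simp: measure_pmf_zero_iff)
  then have "cdf (distr (measure_pmf (p n)) borel (f n)) (c - 1) = 0"
    by (simp add: cdf_def measure_distr)
  with m[of n] n show False
    by simp
qed

text \<open>Cauchy-Schwarz for a centred \<open>g\<close> of variance 1: subtracting from
  \<open>f - \<mu>\<close> its projection \<open>c * g\<close> leaves a residual whose second moment
  is the variance of \<open>f\<close> minus \<open>c^2\<close>, hence nonnegative.\<close>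

lemma expectation_covariance_sq_le_variance:
  fixes f g :: "'a \<Rightarrow> real"
  assumes fin: "finite (set_pmf p)"
    and "measure_pmf.expectation p g = 0" and g_sq: "\<And>x. (g x)\<^sup>2 = 1"
  shows "(measure_pmf.expectation p (\<lambda>x. f x * g x))\<^sup>2 \<le> measure_pmf.variance p f"
proof -
  note [simp] = integrable_measure_pmf_finite[OF fin]
  define \<mu> where "\<mu> = measure_pmf.expectation p f"
  define c where "c = measure_pmf.expectation p (\<lambda>x. f x * g x)"
  have "0 \<le> measure_pmf.expectation p (\<lambda>x. ((f x - \<mu>) - c * g x)\<^sup>2)"
    by (simp add: integral_nonneg)
  also have "(\<lambda>x. ((f x - \<mu>) - c * g x)\<^sup>2)
      = (\<lambda>x. (f x - \<mu>)\<^sup>2 - 2 * c * (f x * g x) + 2 * c * \<mu> * g x + c\<^sup>2)"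
    using g_sq by (auto simp: fun_eq_iff power2_eq_square algebra_simps)
  also have "measure_pmf.expectation p \<dots> = measure_pmf.variance p f - c\<^sup>2"
    using assms(2) by (simp add: \<mu>_def[symmetric] c_def[symmetric] power2_eq_square)
  finally show ?thesis
    by (simp add: c_def)
qed

text \<open>The colouring is uniform on a finite set of functions, which the flip permutes, being
  its own inverse. Since \<open>v\<close> is a vertex, the flip leaves the dummy value
  \<open>False\<close> outside the vertex set alone.\<close>

lemma map_pmf_flip_random_colouring:
  assumes "finite (pverts G)" "v \<in> pverts G"
  shows "map_pmf (\<lambda>x. x(v := \<not> x v)) (random_colouring G) = random_colouring G"
proof -
  have "bij_betw (\<lambda>x. x(v := \<not> x v)) (PiE_dflt (pverts G) False (\<lambda>_. UNIV))
      (PiE_dflt (pverts G) False (\<lambda>_. UNIV))"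
    by (rule bij_betwI[of _ _ _ "\<lambda>x. x(v := \<not> x v)"])
      (use assms in \<open>auto simp: PiE_dflt_def\<close>)
  then have "map_pmf (\<lambda>x. x(v := \<not> x v)) (pmf_of_set (PiE_dflt (pverts G) False (\<lambda>_. UNIV)))
      = pmf_of_set (PiE_dflt (pverts G) False (\<lambda>_. UNIV))"
    using assms by (intro map_pmf_of_set_bij_betw) (auto intro: finite_PiE_dflt)
  then show ?thesis
    using assms by (simp add: random_colouring_def Pi_pmf_of_set)
qed

lemma finite_set_random_colouring:
  "finite (pverts G) \<Longrightarrow> finite (set_pmf (random_colouring G))"
  by (simp add: random_colouring_def set_Pi_pmf o_def finite_PiE_dflt)

text \<open>The flip preserves the law but negates \<open>f\<close>, so the expectation equals its
  own negative.\<close>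

lemma expectation_random_colouring_eq_0:
  fixes f :: "('v \<Rightarrow> bool) \<Rightarrow> real"
  assumes "finite (pverts G)" "v \<in> pverts G" "\<And>x. f (x(v := \<not> x v)) = - f x"
  shows "measure_pmf.expectation (random_colouring G) f = 0"
proof -
  have "measure_pmf.expectation (random_colouring G) f
      = measure_pmf.expectation (map_pmf (\<lambda>x. x(v := \<not> x v)) (random_colouring G)) f"
    by (simp add: map_pmf_flip_random_colouring assms)
  also have "\<dots> = - measure_pmf.expectation (random_colouring G) f"
    by (simp add: assms(3))
  finally show ?thesis
    by simp
qed

text \<open>Only the event that all of \<open>S\<close> gets the colour \<open>True\<close> is
  counted. Adding the other colour would double the bound, which fails for empty
  \<open>S\<close>.\<close>

lemma prob_monochromatic_ge:
  assumes fin: "finite (pverts G)" and S: "S \<subseteq> pverts G"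
  shows "(1/2) ^ card S \<le> measure_pmf.prob (random_colouring G) {x. \<exists>c. \<forall>v\<in>S. x v = c}"
proof -
  \<comment> \<open>Padding with factors 1 outside \<open>S\<close> gives a product over all
    vertices, as independence requires.\<close>
  have "(1/2) ^ card S = (\<Prod>v\<in>pverts G. if v \<in> S then 1/2 else 1 :: real)"
    using S fin by (simp add: prod.If_cases Int_absorb1)
  also have "\<dots> = measure_pmf.prob (random_colouring G)
      (Pi (pverts G) (\<lambda>v. if v \<in> S then {True} else UNIV))"
    unfolding random_colouring_def measure_Pi_pmf_Pi[OF fin]
    by (intro prod.cong refl) (simp add: measure_pmf_of_set)
  also have "\<dots> \<le> measure_pmf.prob (random_colouring G) {x. \<exists>c. \<forall>v\<in>S. x v = c}"
  proof (intro measure_pmf.finite_measure_mono subsetI CollectI exI ballI)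
    fix x v assume "x \<in> Pi (pverts G) (\<lambda>v. if v \<in> S then {True} else UNIV)" "v \<in> S"
    then have "x v \<in> (if v \<in> S then {True} else UNIV)"
      using S by (intro Pi_mem[of x "pverts G" "\<lambda>v. if v \<in> S then {True} else UNIV" v]) blast+
    with \<open>v \<in> S\<close> show "x v = True"
      by simp
  qed simp
  finally show ?thesis .
qed

lemma copiesD:
  assumes "K \<in> copies H G"
  shows "pverts K \<subseteq> pverts G" "parcs K \<subseteq> parcs G" "card (pverts K) = card (pverts H)"
proof -
  show "pverts K \<subseteq> pverts G" "parcs K \<subseteq> parcs G"
    using assms by (auto simp: copies_def subgraph_def)
  from assms obtain f where
    "pre_digraph.digraph_isomorphism (with_proj K) f" "with_proj H = app_iso f (with_proj K)"
    by (auto simp: copies_def digraph_iso_def)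
  then have "inj_on (iso_verts f) (pverts K)" "pverts H = iso_verts f ` pverts K"
    by (auto simp: pre_digraph.digraph_isomorphism_def verts_app_iso dest: arg_cong[where f = verts])
  then show "card (pverts K) = card (pverts H)"
    by (simp add: card_image)
qed

lemma finite_copies:
  assumes "pair_graph G"
  shows "finite (copies H G)"
proof (rule finite_subset)
  interpret pair_graph G by fact
  show "finite ((\<lambda>(V, A). \<lparr>pverts = V, parcs = A\<rparr>) ` (Pow (pverts G) \<times> Pow (parcs G)))"
    by simp
  show "copies H G \<subseteq> (\<lambda>(V, A). \<lparr>pverts = V, parcs = A\<rparr>) ` (Pow (pverts G) \<times> Pow (parcs G))"
  proof
    fix K assume K: "K \<in> copies H G"
    then have "K = (\<lambda>(V, A). \<lparr>pverts = V, parcs = A\<rparr>) (pverts K, parcs K)"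
      by simp
    with copiesD[OF K] show "K \<in> (\<lambda>(V, A). \<lparr>pverts = V, parcs = A\<rparr>) ` (Pow (pverts G) \<times> Pow (parcs G))"
      by blast
  qed
qed

lemma sqrt_variance_mono_copies_ge:
  fixes G :: "'a pair_pre_digraph"
  assumes G: "pair_graph G" and "v \<in> pverts G" "w \<in> pverts G" "v \<noteq> w"
  shows "real (num_copies_through (v, w) H G) / 2 ^ card (pverts H)
    \<le> sqrt (measure_pmf.variance (random_colouring G) (mono_copies H G))"
proof -
  interpret pair_graph G by fact
  have fin: "finite (pverts G)"
    by (rule pair_finite_verts)
  note [simp] = integrable_measure_pmf_finite[OF finite_set_random_colouring[OF fin]]
  define E :: "(('a \<Rightarrow> bool) \<Rightarrow> real) \<Rightarrow> real"
    where "E = measure_pmf.expectation (random_colouring G)"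
  define Y :: "('a \<Rightarrow> bool) \<Rightarrow> real" where "Y x = (if x v = x w then 1 else -1)" for x :: "'a \<Rightarrow> bool"
  define mono :: "'a pair_pre_digraph \<Rightarrow> ('a \<Rightarrow> bool) set"
    where "mono K = {x. \<exists>c. \<forall>u\<in>pverts K. x u = c}" for K
  have EY: "E Y = 0"
    unfolding E_def using assms
    by (intro expectation_random_colouring_eq_0[OF fin, of v]) (auto simp: Y_def)
  have T: "mono_copies H G x = (\<Sum>K\<in>copies H G. indicator (mono K) x)" for x
    unfolding mono_copies_def using finite_copies[OF G, of H]
    by (simp add: mono_def indicator_def sum_of_bool_eq Int_def)
  have through: "E (\<lambda>x. indicator (mono K) x * Y x) \<ge> (1/2) ^ card (pverts H)"
    if K: "K \<in> copies H G" and vw: "v \<in> pverts K" "w \<in> pverts K" for K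
  proof -
    have "(\<lambda>x. indicator (mono K) x * Y x) = indicator (mono K)"
      using vw by (auto simp: fun_eq_iff indicator_def Y_def mono_def)
    then have "E (\<lambda>x. indicator (mono K) x * Y x) = measure_pmf.prob (random_colouring G) (mono K)"
      by (simp add: E_def)
    with prob_monochromatic_ge[OF fin copiesD(1)[OF K]] copiesD(3)[OF K] show ?thesis
      by (simp add: mono_def)
  qed
  \<comment> \<open>Flipping the missing vertex \<open>u\<close> does not affect whether
    \<open>K\<close> is monochromatic, whereas it negates \<open>Y\<close> because \<open>v\<close>
    and \<open>w\<close> are distinct.\<close>
  have avoiding: "E (\<lambda>x. indicator (mono K) x * Y x) = 0"
    if "u \<notin> pverts K" "u = v \<or> u = w" for K u
  proof -
    have "x(u := b) \<in> mono K \<longleftrightarrow> x \<in> mono K" for x b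
      unfolding mono_def mem_Collect_eq using that(1)
      by (intro ex_cong1 ball_cong) auto
    moreover have "Y (x(u := \<not> x u)) = - Y x" for x
      using that(2) assms by (auto simp: Y_def)
    ultimately show ?thesis
      unfolding E_def using that(2) assms
      by (intro expectation_random_colouring_eq_0[OF fin, of u]) (auto simp: indicator_def)
  qed
  let ?D = "{K \<in> copies H G. v \<in> pverts K \<and> w \<in> pverts K}"
  have "real (num_copies_through (v, w) H G) / 2 ^ card (pverts H)
      = (\<Sum>K\<in>?D. (1/2) ^ card (pverts H))"
    by (simp add: num_copies_through_def power_divide)
  also have "\<dots> \<le> (\<Sum>K\<in>?D. E (\<lambda>x. indicator (mono K) x * Y x))"
    using through by (intro sum_mono) auto
  also have "\<dots> = (\<Sum>K\<in>copies H G. E (\<lambda>x. indicator (mono K) x * Y x))"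
    using avoiding by (intro sum.mono_neutral_left finite_copies[OF G]) auto
  also have "\<dots> = E (\<lambda>x. mono_copies H G x * Y x)"
    unfolding E_def T sum_distrib_right by (rule Bochner_Integration.integral_sum[symmetric]) simp
  also have "\<dots> \<le> sqrt (measure_pmf.variance (random_colouring G) (mono_copies H G))"
    using expectation_covariance_sq_le_variance[OF finite_set_random_colouring[OF fin]
        EY[unfolded E_def], of "mono_copies H G"]
    by (intro real_le_rsqrt) (auto simp: E_def Y_def)
  finally show ?thesis .
qed

lemma standardized_mono_copies_ge:
  assumes G: "pair_graph G" and ne: "copies H G \<noteq> {}" and "\<epsilon> > 0"
    and infl: "strongly_influential \<epsilon> H G e"
  shows "- (2 ^ card (pverts H) / \<epsilon>) \<le> standardized_mono_copies H G x"
proof -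
  interpret pair_graph G by fact
  obtain v w where e: "e = (v, w)"
    by (cases e)
  define N where "N = real (num_copies H G)"
  define r where "r = card (pverts H)"
  define \<mu> where "\<mu> = measure_pmf.expectation (random_colouring G) (mono_copies H G)"
  define \<sigma> where "\<sigma> = sqrt (measure_pmf.variance (random_colouring G) (mono_copies H G))"
  have "N > 0"
    using ne finite_copies[OF G] by (simp add: N_def num_copies_def card_gt_0_iff)
  have "\<epsilon> * N / 2 ^ r \<le> real (num_copies_through (v, w) H G) / 2 ^ r"
    using infl by (simp add: e strongly_influential_def N_def divide_right_mono)
  also have "\<dots> \<le> \<sigma>"
    using infl unfolding r_def \<sigma>_def
    by (intro sqrt_variance_mono_copies_ge[OF G]) (auto simp: e strongly_influential_def)
  finally have \<sigma>: "\<epsilon> * N / 2 ^ r \<le> \<sigma>" .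
  moreover have "\<epsilon> * N / 2 ^ r > 0"
    using \<open>N > 0\<close> \<open>\<epsilon> > 0\<close> by simp
  \<comment> \<open>Positivity excludes the degenerate case of division by zero in the
    standardization and allows multiplying through by \<open>\<sigma>\<close>.\<close>
  ultimately have "\<sigma> > 0"
    by linarith
  have le_N: "mono_copies H G y \<le> N" for y
    using finite_copies[OF G] by (auto simp: mono_copies_def N_def num_copies_def intro!: card_mono)
  have "\<mu> \<le> N"
    unfolding \<mu>_def using le_N finite_set_random_colouring[OF pair_finite_verts]
    by (intro measure_pmf.integral_le_const) (auto intro: integrable_measure_pmf_finite)
  have "- (2 ^ r / \<epsilon>) * \<sigma> \<le> - (2 ^ r / \<epsilon>) * (\<epsilon> * N / 2 ^ r)"
    using \<sigma> \<open>\<epsilon> > 0\<close> by (intro mult_left_mono_neg) auto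
  also have "\<dots> = - N"
    using \<open>\<epsilon> > 0\<close> by simp
  also have "\<dots> \<le> mono_copies H G x - \<mu>"
    using \<open>\<mu> \<le> N\<close> by (simp add: mono_copies_def)
  finally show ?thesis
    using \<open>\<sigma> > 0\<close> unfolding standardized_mono_copies_def \<sigma>_def[symmetric]
    by (simp add: pos_le_divide_eq \<mu>_def r_def)
qed

theorem proposition5p8:
  fixes H :: "'h pair_pre_digraph" and G :: "nat \<Rightarrow> 'v pair_pre_digraph" and \<epsilon> :: real
  assumes "pair_graph H" and "Digraph_Component.connected (with_proj H)" and "card (pverts H) \<ge> 2"
    and "\<And>n. pair_graph (G n)"
    and "\<And>n. copies H (G n) \<noteq> {}"
    and "\<epsilon> > 0"
    and "\<forall>m. \<exists>n>m. \<exists>w. strongly_influential \<epsilon> H (G n) w"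
  shows "\<not> weak_conv_m
    (\<lambda>n. distr (random_colouring (G n)) borel (standardized_mono_copies H (G n)))
    std_normal_distribution"
  \<comment> \<open>The lower bound depends only on \<open>H\<close> and \<open>\<epsilon>\<close>,
    so one constant serves for all \<open>n\<close>.\<close>
  using assms(4-7)
  by (intro not_weak_conv_std_normal_if_bounded_below[of _ "- (2 ^ card (pverts H) / \<epsilon>)"])
    (blast intro: standardized_mono_copies_ge)

end
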